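(* Let $(\Omega,\mathcal{E})$ be a measurable space and let $X$ be a Hausdorff space with second countable compacts. Let $F_1,F_2,\ldots$ be a sequence of closed-valued compact-measurable multifunctions $F_n:\Omega\to X$. Then the multifunction $\omega\mapsto\bigcap_{n\ge 1}F_n(\omega)$ is compact-measurable.
   Context: A multifunction $F:\Omega\to X$ is a function assigning to each $\omega\in\Omega$ a (possibly empty) subset $F(\omega)\subset X$; it is closed-valued if every $F(\omega)$ is closed. $F$ is compact-measurable if $F^{-1}(K)=\{\omega : F(\omega)\cap K\neq\emptyset\}$ belongs to $\mathcal{E}$ for every compact $K\subset X$. A topological space $X$ has second countable compacts if every compact subset of $X$ is second countable in its relative topology. *)

theory Defs
  imports "HOL-Analysis.Analysis"
begin

definition multifunction :: "'a set \<Rightarrow> 'b topology \<Rightarrow> ('a \<Rightarrow> 'b set) \<Rightarrow> bool" where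
  "multifunction \<Omega> X F \<longleftrightarrow> (\<forall>\<omega>\<in>\<Omega>. F \<omega> \<subseteq> topspace X)"

definition closed_valued :: "'a set \<Rightarrow> 'b topology \<Rightarrow> ('a \<Rightarrow> 'b set) \<Rightarrow> bool" where
  "closed_valued \<Omega> X F \<longleftrightarrow> (\<forall>\<omega>\<in>\<Omega>. closedin X (F \<omega>))"

definition multi_preimage :: "'a set \<Rightarrow> ('a \<Rightarrow> 'b set) \<Rightarrow> 'b set \<Rightarrow> 'a set" where
  "multi_preimage \<Omega> F K = {\<omega> \<in> \<Omega>. F \<omega> \<inter> K \<noteq> {}}"

definition compact_measurable ::
    "'a set \<Rightarrow> 'a set set \<Rightarrow> 'b topology \<Rightarrow> ('a \<Rightarrow> 'b set) \<Rightarrow> bool" where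
  "compact_measurable \<Omega> \<E> X F \<longleftrightarrow> (\<forall>K. compactin X K \<longrightarrow> multi_preimage \<Omega> F K \<in> \<E>)"

definition second_countable_compacts :: "'b topology \<Rightarrow> bool" where
  "second_countable_compacts X \<longleftrightarrow>
     (\<forall>K. compactin X K \<longrightarrow> second_countable (subtopology X K))"

end

theory Submission
  imports Defs
begin

text \<open>
  If the closed sets \<open>F\<^sub>n(\<omega>)\<close> have no common point in the compact set \<open>K\<close>, then by regularity
  every point of \<open>K\<close> has a basic neighbourhood in \<open>K\<close> whose closure misses some \<open>F\<^sub>n(\<omega>)\<close>, and
  finitely many of these cover \<open>K\<close>. Conversely, such a finite cover excludes a common point.
  A countable base allows only countably many finite covers, and \<open>F\<^sub>n(\<omega>)\<close> missing the compact
  closure of a basic set is a measurable condition on \<open>\<omega>\<close>.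
\<close>

text \<open>The sets \<open>T\<close> range over finite subsets of \<open>\<B> \<times> I\<close>, a
  collection independent of \<open>A\<close>, so one index set will serve all \<omega>. The cover
  uses closures because these are compact, as compact-measurability requires.\<close>

lemma disjoint_closed_family_iff_finite_cover:
  assumes "compact_space Y" "regular_space Y"
    and open_base: "\<And>V. V \<in> \<B> \<Longrightarrow> openin Y V"
    and base: "\<And>U x. openin Y U \<Longrightarrow> x \<in> U \<Longrightarrow> \<exists>V\<in>\<B>. x \<in> V \<and> V \<subseteq> U"
    and closed: "\<And>i. i \<in> I \<Longrightarrow> closedin Y (A i)"
  shows "topspace Y \<inter> (\<Inter>i\<in>I. A i) = {} \<longleftrightarrow>
    (\<exists>T. finite T \<and> T \<subseteq> \<B> \<times> I \<and> topspace Y \<subseteq> (\<Union>(V, i)\<in>T. Y closure_of V) \<and>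
      (\<forall>(V, i)\<in>T. A i \<inter> Y closure_of V = {}))"
    (is "?L \<longleftrightarrow> ?R")
proof
  assume empty: ?L
  \<comment> \<open>Pairs rather than sets \<open>V\<close> alone, so that each neighbourhood
    remembers an index whose set its closure misses.\<close>
  define P where "P = {(V, i). V \<in> \<B> \<and> i \<in> I \<and> A i \<inter> Y closure_of V = {}}"
  have "\<exists>p\<in>P. x \<in> fst p" if x: "x \<in> topspace Y" for x
  proof -
    obtain i where i: "i \<in> I" "x \<notin> A i"
      using x empty by blast
    then have "openin Y (topspace Y - A i)" "x \<in> topspace Y - A i"
      using closed x by blast+
    \<comment> \<open>The closed set \<open>C\<close> between \<open>U\<close> and the complement of
      \<open>A i\<close> keeps the closure of any basic \<open>V \<subseteq> U\<close> away from
      \<open>A i\<close>.\<close>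
    then obtain U C where UC: "openin Y U" "closedin Y C" "x \<in> U" "U \<subseteq> C" "C \<subseteq> topspace Y - A i"
      using \<open>regular_space Y\<close>
      unfolding neighbourhood_base_of_closedin [symmetric] neighbourhood_base_of by metis
    then obtain V where V: "V \<in> \<B>" "x \<in> V" "V \<subseteq> U"
      using base by meson
    have "Y closure_of V \<subseteq> C"
      using UC V by (intro closure_of_minimal) auto
    then have "(V, i) \<in> P"
      using UC V i by (auto simp: P_def)
    with V show ?thesis by force
  qed
  then have "topspace Y \<subseteq> \<Union> (fst ` P)"
    by blast
  moreover have "openin Y V" if "V \<in> fst ` P" for V
    using that open_base by (auto simp: P_def)
  ultimately obtain \<F> where \<F>: "finite \<F>" "\<F> \<subseteq> fst ` P" "topspace Y \<subseteq> \<Union>\<F>"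
    using \<open>compact_space Y\<close> unfolding compact_space_def compactin_def by meson
  \<comment> \<open>Compactness only yields finitely many first components; lifting them through
    \<open>fst\<close> selects finitely many pairs.\<close>
  then obtain T where T: "finite T" "T \<subseteq> P" "\<F> = fst ` T"
    by (meson finite_subset_image)
  have "V \<subseteq> Y closure_of V" if "V \<in> \<F>" for V
    using that \<F>(2) open_base by (intro closure_of_subset openin_subset) (auto simp: P_def)
  then have "topspace Y \<subseteq> (\<Union>(V, i)\<in>T. Y closure_of V)"
    using \<F>(3) unfolding T(3) split_def by blast
  with T(1,2) show ?R
    unfolding P_def by blast
next
  assume ?R
  then obtain T where T: "T \<subseteq> \<B> \<times> I" "topspace Y \<subseteq> (\<Union>(V, i)\<in>T. Y closure_of V)"
    and disjoint: "\<And>V i. (V, i) \<in> T \<Longrightarrow> A i \<inter> Y closure_of V = {}"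
    by blast
  show ?L
  proof (rule equals0I)
    fix x assume x: "x \<in> topspace Y \<inter> (\<Inter>i\<in>I. A i)"
    then obtain V i where "(V, i) \<in> T" "x \<in> Y closure_of V"
      using T(2) by blast
    with x T(1) disjoint show False by blast
  qed
qed

theorem theorem3p3:
  fixes \<Omega> :: "'a set" and \<E> :: "'a set set" and X :: "'b topology"
    and F :: "nat \<Rightarrow> 'a \<Rightarrow> 'b set"
  assumes "sigma_algebra \<Omega> \<E>"
    and "Hausdorff_space X"
    and "second_countable_compacts X"
    and "\<And>n. n \<ge> 1 \<Longrightarrow> multifunction \<Omega> X (F n)"
    and "\<And>n. n \<ge> 1 \<Longrightarrow> closed_valued \<Omega> X (F n)"
    and "\<And>n. n \<ge> 1 \<Longrightarrow> compact_measurable \<Omega> \<E> X (F n)"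
  shows "compact_measurable \<Omega> \<E> X (\<lambda>\<omega>. \<Inter>n\<in>{1..}. F n \<omega>)"
  unfolding compact_measurable_def
proof (intro allI impI)
  fix K assume K: "compactin X K"
  interpret sigma_algebra \<Omega> \<E> by fact
  define Y where "Y = subtopology X K"
  have top: "topspace Y = K"
    using compactin_subset_topspace[OF K] by (auto simp: Y_def)
  have cpt: "compact_space Y"
    using K by (simp add: Y_def compact_space_subtopology)
  have reg: "regular_space Y"
    using cpt \<open>Hausdorff_space X\<close>
    by (simp add: Y_def Hausdorff_space_subtopology compact_Hausdorff_imp_regular_space)
  obtain \<B> where \<B>: "countable \<B>" "\<And>V. V \<in> \<B> \<Longrightarrow> openin Y V"
      "\<And>U x. openin Y U \<Longrightarrow> x \<in> U \<Longrightarrow> \<exists>V\<in>\<B>. x \<in> V \<and> V \<subseteq> U"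
    using \<open>second_countable_compacts X\<close> K
    unfolding second_countable_compacts_def second_countable_def Y_def by metis
  \<comment> \<open>These are the conditions on a cover that do not mention \<omega>; the remaining
    one is expressed by \<open>M\<close> below.\<close>
  define \<T> where "\<T> = {T. finite T \<and> T \<subseteq> \<B> \<times> {1::nat..} \<and> K \<subseteq> (\<Union>(V, n)\<in>T. Y closure_of V)}"
  have "countable {T. finite T \<and> T \<subseteq> \<B> \<times> {1::nat..}}"
    using \<B>(1) by (intro countable_Collect_finite_subset) auto
  then have "countable \<T>"
    by (rule countable_subset[rotated]) (auto simp: \<T>_def)
  define M where "M p = \<Omega> - multi_preimage \<Omega> (F (snd p)) (Y closure_of (fst p))"
    for p :: "'b set \<times> nat"
  \<comment> \<open>A closure taken in the compact space \<open>Y\<close> is compact in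
    \<open>Y\<close>, hence in \<open>X\<close>, so the hypothesis on \<open>F (snd p)\<close>
    applies.\<close>
  have M: "M p \<in> \<E>" if "snd p \<ge> 1" for p
  proof -
    have "compactin Y (Y closure_of (fst p))"
      using cpt by (simp add: closedin_compact_space)
    then have "compactin X (Y closure_of (fst p))"
      by (simp add: Y_def compactin_subtopology)
    then show ?thesis
      using assms(6)[OF that] by (auto simp: M_def compact_measurable_def)
  qed
  have disjoint_iff: "(\<Inter>n\<in>{1..}. F n \<omega>) \<inter> K = {} \<longleftrightarrow> (\<exists>T\<in>\<T>. \<forall>p\<in>T. \<omega> \<in> M p)"
    if "\<omega> \<in> \<Omega>" for \<omega>
  proof -
    have closed: "closedin Y (K \<inter> F n \<omega>)" if "n \<in> {1..}" for n
      using assms(5)[of n] that \<open>\<omega> \<in> \<Omega>\<close>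
      by (auto simp: Y_def closed_valued_def intro: closedin_subtopology_Int_closed)
    \<comment> \<open>Since closures in \<open>Y\<close> stay inside \<open>K\<close>, missing the
      trace \<open>K \<inter> F n \<omega>\<close> is the same as missing
      \<open>F n \<omega>\<close> itself.\<close>
    have sub: "Y closure_of V \<subseteq> K" for V
      using closure_of_subset_topspace[of Y V] top by simp
    have "(\<Inter>n\<in>{1..}. F n \<omega>) \<inter> K = {} \<longleftrightarrow> topspace Y \<inter> (\<Inter>n\<in>{1..}. K \<inter> F n \<omega>) = {}"
      by (auto simp: top)
    also have "\<dots> \<longleftrightarrow> (\<exists>T. finite T \<and> T \<subseteq> \<B> \<times> {1..} \<and>
        topspace Y \<subseteq> (\<Union>(V, n)\<in>T. Y closure_of V) \<and>
        (\<forall>(V, n)\<in>T. (K \<inter> F n \<omega>) \<inter> Y closure_of V = {}))"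
      using \<B> closed by (intro disjoint_closed_family_iff_finite_cover cpt reg) auto
    also have "\<dots> \<longleftrightarrow> (\<exists>T\<in>\<T>. \<forall>(V, n)\<in>T. (K \<inter> F n \<omega>) \<inter> Y closure_of V = {})"
      by (auto simp: \<T>_def top)
    also have "\<dots> \<longleftrightarrow> (\<exists>T\<in>\<T>. \<forall>(V, n)\<in>T. \<omega> \<in> M (V, n))"
    proof -
      have "(K \<inter> F n \<omega>) \<inter> Y closure_of V = {} \<longleftrightarrow> \<omega> \<in> M (V, n)" for V n
        using sub[of V] \<open>\<omega> \<in> \<Omega>\<close> by (auto simp: M_def multi_preimage_def)
      then show ?thesis by simp
    qed
    finally show ?thesis
      by (simp add: split_def)
  qed
  \<comment> \<open>The complement is a countable union, over \<open>\<T>\<close>, of finite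
    intersections of sets \<open>M p\<close>. Restricting to \<open>\<Omega>\<close> gives the right
    value for \<open>T = {}\<close>, which lies in \<open>\<T>\<close> exactly when \<open>K\<close>
    is empty.\<close>
  have "multi_preimage \<Omega> (\<lambda>\<omega>. \<Inter>n\<in>{1..}. F n \<omega>) K = \<Omega> - (\<Union>T\<in>\<T>. {\<omega>\<in>\<Omega>. \<forall>p\<in>T. \<omega> \<in> M p})"
    using disjoint_iff by (auto simp: multi_preimage_def)
  moreover have "{\<omega>\<in>\<Omega>. \<forall>p\<in>T. \<omega> \<in> M p} \<in> \<E>" if "T \<in> \<T>" for T
  proof (rule sets_Collect_finite_All)
    show "{\<omega>\<in>\<Omega>. \<omega> \<in> M p} \<in> \<E>" if "p \<in> T" for p
    proof -
      have "{\<omega>\<in>\<Omega>. \<omega> \<in> M p} = M p"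
        by (auto simp: M_def)
      then show ?thesis
        using M[of p] that \<open>T \<in> \<T>\<close> by (auto simp: \<T>_def)
    qed
    show "finite T"
      using that by (simp add: \<T>_def)
  qed
  ultimately show "multi_preimage \<Omega> (\<lambda>\<omega>. \<Inter>n\<in>{1..}. F n \<omega>) K \<in> \<E>"
    using countable_UN'[OF \<open>countable \<T>\<close>, of "\<lambda>T. {\<omega>\<in>\<Omega>. \<forall>p\<in>T. \<omega> \<in> M p}"] compl_sets
    by (metis (no_types, lifting) image_subset_iff)
qed

end
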